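(* Let $K\ge1$, $P_{\max}>0$, $\Gamma_{\mathrm{sen}},\Gamma_{\mathrm{com}}\ge0$, and $\tilde\gamma_{\mathrm c,k},\tilde\gamma_{\mathrm s,k}>0$ for $k=1,\dots,K$. Consider $$\max_{P_1,\dots,P_K}\ \frac1K\sum_{k=1}^K\log_2(1+P_k\tilde\gamma_{\mathrm c,k})\quad\text{s.t.}\quad\sum_{k=1}^KP_k\le P_{\max},\quad P_k\tilde\gamma_{\mathrm s,k}\ge\Gamma_{\mathrm{sen}},\quad \log_2(1+P_k\tilde\gamma_{\mathrm c,k})\ge\Gamma_{\mathrm{com}}\quad\forall k,$$ and put $\Gamma_k=\max\{(2^{\Gamma_{\mathrm{com}}}-1)/\tilde\gamma_{\mathrm c,k},\ \Gamma_{\mathrm{sen}}/\tilde\gamma_{\mathrm s,k}\}$. If the problem is feasible, then the optimal power allocation is $$P_k^\star=\max\{\Gamma_k,\ W^\star-1/\tilde\gamma_{\mathrm c,k}\},\qquad k=1,\dots,K,$$ where the water level $W^\star$ is chosen such that $\sum_{k=1}^KP_k^\star=P_{\max}$.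
   Context: This is the power-allocation problem over $K$ time slots for fixed antenna positions. $\tilde\gamma_{\mathrm c,k}$ and $\tilde\gamma_{\mathrm s,k}$ are the communication and sensing SNRs per unit transmit power in slot $k$, so that $P_k\tilde\gamma_{\mathrm c,k}$ and $P_k\tilde\gamma_{\mathrm s,k}$ are the actual SNRs. *)

theory Defs
  imports Complex_Main
begin

text \<open>
  Slots are the indices \<open>1, \<dots>, K\<close>; an allocation is a function on \<open>nat\<close> of which only the
  values on \<open>{1..K}\<close> are relevant. The arguments \<open>gc\<close> and \<open>gs\<close> are the communication and sensing
  SNRs per unit transmit power.
\<close>

definition avg_rate :: "nat \<Rightarrow> (nat \<Rightarrow> real) \<Rightarrow> (nat \<Rightarrow> real) \<Rightarrow> real" where
  "avg_rate K gc P = (1 / real K) * (\<Sum>k=1..K. log 2 (1 + P k * gc k))"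

text \<open>
  Nonnegativity of the powers is not a separate constraint: for \<open>gs k > 0\<close> and \<open>\<Gamma>sen \<ge> 0\<close> it
  follows from the sensing constraint, so \<open>log\<close> is only used at arguments \<open>\<ge> 1\<close>.
\<close>

definition feasible ::
  "nat \<Rightarrow> real \<Rightarrow> real \<Rightarrow> real \<Rightarrow> (nat \<Rightarrow> real) \<Rightarrow> (nat \<Rightarrow> real) \<Rightarrow> (nat \<Rightarrow> real) \<Rightarrow> bool" where
  "feasible K Pmax \<Gamma>sen \<Gamma>com gc gs P \<longleftrightarrow>
     (\<Sum>k=1..K. P k) \<le> Pmax \<and>
     (\<forall>k\<in>{1..K}. P k * gs k \<ge> \<Gamma>sen) \<and>
     (\<forall>k\<in>{1..K}. log 2 (1 + P k * gc k) \<ge> \<Gamma>com)"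

definition optimal ::
  "nat \<Rightarrow> real \<Rightarrow> real \<Rightarrow> real \<Rightarrow> (nat \<Rightarrow> real) \<Rightarrow> (nat \<Rightarrow> real) \<Rightarrow> (nat \<Rightarrow> real) \<Rightarrow> bool" where
  "optimal K Pmax \<Gamma>sen \<Gamma>com gc gs P \<longleftrightarrow>
     is_arg_max (avg_rate K gc) (feasible K Pmax \<Gamma>sen \<Gamma>com gc gs) P"

definition min_power ::
  "real \<Rightarrow> real \<Rightarrow> (nat \<Rightarrow> real) \<Rightarrow> (nat \<Rightarrow> real) \<Rightarrow> nat \<Rightarrow> real" where
  "min_power \<Gamma>sen \<Gamma>com gc gs k = max ((2 powr \<Gamma>com - 1) / gc k) (\<Gamma>sen / gs k)"

definition water_filling ::
  "real \<Rightarrow> real \<Rightarrow> (nat \<Rightarrow> real) \<Rightarrow> (nat \<Rightarrow> real) \<Rightarrow> real \<Rightarrow> nat \<Rightarrow> real" where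
  "water_filling \<Gamma>sen \<Gamma>com gc gs W k = max (min_power \<Gamma>sen \<Gamma>com gc gs k) (W - 1 / gc k)"

end

(* The multiplier of the power constraint is 1/W. Concavity of ln at the allocation Q gives
   ln (1 + P g) - ln (1 + Q g) <= (P - Q) / (Q + 1/g), strictly unless P = Q. Here Q + 1/g = W in
   the slots whose minimum power is not binding; in the other slots Q + 1/g >= W and P >= Q. So
   the right-hand side is at most (P - Q) / W, and the sum over all slots is at most 0. If W <= 0,
   every slot is at its minimum power and Q is the only feasible allocation. *)

theory Submission
  imports Defs
begin

text \<open>Strict concavity of \<open>ln\<close>: equality in ln t \<le> t - 1 holds only at t = 1,
  used here with t = x / y.\<close>

lemma ln_tangent_strict:
  fixes x y :: real
  assumes "x > 0" and "y > 0" and "x \<noteq> y"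
  shows "ln x < ln y + (x - y) / y"
proof -
  have "ln (x / y) \<le> x / y - 1" and "ln (x / y) \<noteq> x / y - 1"
    using assms ln_le_minus_one[of "x / y"] ln_eq_minus_one[of "x / y"] by auto
  then show ?thesis
    using assms by (simp add: ln_div diff_divide_distrib)
qed

lemma ln_less_water_level:
  fixes m g W p :: real
  defines "q \<equiv> max m (W - 1 / g)"
  assumes "g > 0" and "m \<ge> 0" and "W > 0" and "p \<ge> m" and "p \<noteq> q"
  shows "ln (1 + p * g) < ln (1 + q * g) + (p - q) / W"
proof -
  have q0: "q \<ge> 0" using assms by (simp add: q_def)
  have "ln (1 + p * g) < ln (1 + q * g) + (1 + p * g - (1 + q * g)) / (1 + q * g)"
    using assms q0 by (intro ln_tangent_strict) (auto intro!: add_pos_nonneg)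
  also have "(1 + p * g - (1 + q * g)) / (1 + q * g) = (p - q) / (q + 1 / g)"
    using \<open>g > 0\<close> by (simp add: field_simps)
  also have "\<dots> \<le> (p - q) / W"
  proof (cases "m \<le> W - 1 / g")
    case True
    then show ?thesis by (simp add: q_def max_def)
  next
    case False
    then have "q = m" and "W \<le> q + 1 / g" by (auto simp: q_def)
    then show ?thesis using assms by (intro divide_left_mono) auto
  qed
  finally show ?thesis by simp
qed

text \<open>One strict slot suffices for a strict total, so a competitor that differs from
  \<open>q\<close> anywhere on \<open>A\<close> loses. This yields optimality and uniqueness at
  once.\<close>

lemma sum_ln_less_water_level:
  fixes m g p q :: "'a \<Rightarrow> real" and W :: real
  assumes "finite A" and "\<And>k. k \<in> A \<Longrightarrow> g k > 0" and "\<And>k. k \<in> A \<Longrightarrow> m k \<ge> 0"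
    and q: "\<And>k. k \<in> A \<Longrightarrow> q k = max (m k) (W - 1 / g k)"
    and p: "\<And>k. k \<in> A \<Longrightarrow> p k \<ge> m k"
    and le: "sum p A \<le> sum q A"
    and j: "j \<in> A" "p j \<noteq> q j"
  shows "(\<Sum>k\<in>A. ln (1 + p k * g k)) < (\<Sum>k\<in>A. ln (1 + q k * g k))"
proof (cases "W > 0")
  case True
  have strict: "ln (1 + p k * g k) < ln (1 + q k * g k) + (p k - q k) / W"
    if "k \<in> A" "p k \<noteq> q k" for k
    using ln_less_water_level[of "g k" "m k" W "p k"] assms True that by simp
  have "(\<Sum>k\<in>A. ln (1 + p k * g k)) < (\<Sum>k\<in>A. ln (1 + q k * g k) + (p k - q k) / W)"
  proof (rule sum_strict_mono_ex1)
    show "\<forall>k\<in>A. ln (1 + p k * g k) \<le> ln (1 + q k * g k) + (p k - q k) / W"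
    proof
      fix k assume "k \<in> A"
      then show "ln (1 + p k * g k) \<le> ln (1 + q k * g k) + (p k - q k) / W"
        using strict[of k] by (cases "p k = q k") auto
    qed
    show "\<exists>k\<in>A. ln (1 + p k * g k) < ln (1 + q k * g k) + (p k - q k) / W"
      using strict j by blast
  qed fact
  \<comment> \<open>Since 1/W is the same in all slots, the linear terms collect into the difference
    of total powers, whose sign \<open>le\<close> controls.\<close>
  also have "\<dots> = (\<Sum>k\<in>A. ln (1 + q k * g k)) + (sum p A - sum q A) / W"
    by (simp add: sum.distrib sum_subtractf flip: sum_divide_distrib)
  also have "\<dots> \<le> (\<Sum>k\<in>A. ln (1 + q k * g k))"
    using le True by (simp add: divide_nonpos_pos)
  finally show ?thesis .
next
  case False
  have "q k = m k" if "k \<in> A" for k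
  proof -
    have "W - 1 / g k \<le> 0" using False assms(2)[OF that] by (smt (verit) divide_pos_pos)
    then show ?thesis using q[OF that] assms(3)[OF that] by simp
  qed
  \<comment> \<open>With all of \<open>q\<close> at the lower bounds, a different \<open>p\<close>
    would need strictly more total power, against \<open>le\<close>; so this case is
    contradictory.\<close>
  then have "\<forall>k\<in>A. q k \<le> p k" using p by simp
  moreover from this have "\<exists>k\<in>A. q k < p k" using j by force
  ultimately have "sum q A < sum p A"
    using \<open>finite A\<close> by (intro sum_strict_mono_ex1)
  then show ?thesis using le by simp
qed

text \<open>Intermediate value theorem: the total power is continuous in the level, equals
  \<open>sum m A\<close> at level 0, and reaches \<open>S\<close> once the level is high enough for
  one slot to absorb all of \<open>S\<close>.\<close>

lemma water_level_exists:
  fixes m g :: "'a \<Rightarrow> real"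
  assumes "finite A" and "A \<noteq> {}" and g: "\<And>k. k \<in> A \<Longrightarrow> g k > 0"
    and m: "\<And>k. k \<in> A \<Longrightarrow> m k \<ge> 0" and le: "sum m A \<le> S"
  shows "\<exists>W. (\<Sum>k\<in>A. max (m k) (W - 1 / g k)) = S"
proof -
  obtain j where j: "j \<in> A" using \<open>A \<noteq> {}\<close> by blast
  define f where "f W = (\<Sum>k\<in>A. max (m k) (W - 1 / g k))" for W
  have S: "0 \<le> S" using sum_nonneg[of A m] m le by simp
  have "f 0 = sum m A"
    unfolding f_def
  proof (rule sum.cong)
    fix k assume "k \<in> A"
    then have "1 / g k > 0" "m k \<ge> 0" using g m by auto
    then show "max (m k) (0 - 1 / g k) = m k" by linarith
  qed simp
  \<comment> \<open>At this level slot \<open>j\<close> alone receives at least \<open>S\<close>,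
    and the other slots contribute nonnegative amounts.\<close>
  moreover have "S \<le> f (S + 1 / g j)"
  proof -
    have "S \<le> max (m j) (S + 1 / g j - 1 / g j)" by simp
    also have "\<dots> \<le> f (S + 1 / g j)"
      unfolding f_def using j \<open>finite A\<close> m by (intro member_le_sum) (auto simp: le_max_iff_disj)
    finally show ?thesis .
  qed
  moreover have "0 \<le> S + 1 / g j" using S g[OF j] by simp
  moreover have "continuous_on {0..S + 1 / g j} f"
    unfolding f_def by (intro continuous_intros)
  ultimately show ?thesis
    using IVT'[of f 0 S "S + 1 / g j"] le by (auto simp: f_def)
qed

lemma feasible_iff_min_power:
  assumes "\<Gamma>sen \<ge> 0" and gc: "\<forall>k\<in>{1..K}. gc k > 0" and gs: "\<forall>k\<in>{1..K}. gs k > 0"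
  shows "feasible K Pmax \<Gamma>sen \<Gamma>com gc gs P \<longleftrightarrow>
    (\<Sum>k=1..K. P k) \<le> Pmax \<and> (\<forall>k\<in>{1..K}. min_power \<Gamma>sen \<Gamma>com gc gs k \<le> P k)"
proof -
  have "P k * gs k \<ge> \<Gamma>sen \<and> log 2 (1 + P k * gc k) \<ge> \<Gamma>com \<longleftrightarrow>
      min_power \<Gamma>sen \<Gamma>com gc gs k \<le> P k" if "k \<in> {1..K}" for k
  proof -
    have pos: "gc k > 0" "gs k > 0" using that gc gs by auto
    have sen: "P k * gs k \<ge> \<Gamma>sen \<longleftrightarrow> \<Gamma>sen / gs k \<le> P k"
      using pos by (simp add: pos_divide_le_eq)
    \<comment> \<open>The sensing bound forces \<open>P k\<close> \<ge> 0, so the argument of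
      \<open>log\<close> is positive, as inverting the logarithm requires.\<close>
    have com: "log 2 (1 + P k * gc k) \<ge> \<Gamma>com \<longleftrightarrow> (2 powr \<Gamma>com - 1) / gc k \<le> P k"
      if "\<Gamma>sen / gs k \<le> P k"
    proof -
      have "0 \<le> \<Gamma>sen / gs k" using \<open>\<Gamma>sen \<ge> 0\<close> pos by simp
      then have "0 < 1 + P k * gc k" using that pos by (intro add_pos_nonneg) auto
      then show ?thesis using pos by (simp add: le_log_iff pos_divide_le_eq) linarith
    qed
    show ?thesis using sen com by (auto simp: min_power_def)
  qed
  then show ?thesis unfolding feasible_def by blast
qed

lemma avg_rate_eq_sum_ln:
  "avg_rate K gc P = (\<Sum>k=1..K. ln (1 + P k * gc k)) / (real K * ln 2)"
  by (simp add: avg_rate_def log_def sum_divide_distrib[symmetric])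

text \<open>The level is quantified over because it need not be unique: if the minimum powers
  already sum to \<open>Pmax\<close>, every sufficiently low \<open>W\<close> gives the same
  allocation on the slots.\<close>

theorem mainTheorem8:
  fixes K :: nat and Pmax \<Gamma>sen \<Gamma>com :: real and gc gs :: "nat \<Rightarrow> real"
  assumes "K \<ge> 1" and "Pmax > 0" and "\<Gamma>sen \<ge> 0" and "\<Gamma>com \<ge> 0"
    and "\<forall>k\<in>{1..K}. gc k > 0" and "\<forall>k\<in>{1..K}. gs k > 0"
    and "\<exists>P. feasible K Pmax \<Gamma>sen \<Gamma>com gc gs P"
  shows "(\<exists>W. (\<Sum>k=1..K. water_filling \<Gamma>sen \<Gamma>com gc gs W k) = Pmax) \<and>
    (\<forall>W. (\<Sum>k=1..K. water_filling \<Gamma>sen \<Gamma>com gc gs W k) = Pmax \<longrightarrow>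
      optimal K Pmax \<Gamma>sen \<Gamma>com gc gs (water_filling \<Gamma>sen \<Gamma>com gc gs W) \<and>
      (\<forall>P. optimal K Pmax \<Gamma>sen \<Gamma>com gc gs P \<longrightarrow>
        (\<forall>k\<in>{1..K}. P k = water_filling \<Gamma>sen \<Gamma>com gc gs W k)))"
proof -
  let ?m = "min_power \<Gamma>sen \<Gamma>com gc gs"
  let ?q = "water_filling \<Gamma>sen \<Gamma>com gc gs"
  have gc: "gc k > 0" if "k \<in> {1..K}" for k using assms(5) that by blast
  have feas: "feasible K Pmax \<Gamma>sen \<Gamma>com gc gs P \<longleftrightarrow>
      (\<Sum>k=1..K. P k) \<le> Pmax \<and> (\<forall>k\<in>{1..K}. ?m k \<le> P k)" for P
    by (rule feasible_iff_min_power) fact+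
  have m0: "?m k \<ge> 0" if "k \<in> {1..K}" for k
  proof -
    have "gs k > 0" using assms(6) that by blast
    then show ?thesis using assms(3) by (simp add: min_power_def le_max_iff_disj)
  qed
  obtain P0 where "(\<Sum>k=1..K. P0 k) \<le> Pmax" "\<forall>k\<in>{1..K}. ?m k \<le> P0 k"
    using assms(7) feas by blast
  \<comment> \<open>Feasibility enters here: any feasible allocation dominates the minimum powers
    slot by slot.\<close>
  then have "(\<Sum>k=1..K. ?m k) \<le> Pmax"
    using sum_mono[of "{1..K}" ?m P0] by force
  then have "\<exists>W. (\<Sum>k=1..K. ?q W k) = Pmax"
    unfolding water_filling_def using assms(1) gc m0 by (intro water_level_exists) auto
  moreover have "optimal K Pmax \<Gamma>sen \<Gamma>com gc gs (?q W) \<and>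
      (\<forall>P. optimal K Pmax \<Gamma>sen \<Gamma>com gc gs P \<longrightarrow> (\<forall>k\<in>{1..K}. P k = ?q W k))"
    if W: "(\<Sum>k=1..K. ?q W k) = Pmax" for W
  proof -
    have q: "feasible K Pmax \<Gamma>sen \<Gamma>com gc gs (?q W)"
      using W by (simp add: feas water_filling_def)
    have less: "avg_rate K gc P < avg_rate K gc (?q W)"
      if P: "feasible K Pmax \<Gamma>sen \<Gamma>com gc gs P" and "j \<in> {1..K}" "P j \<noteq> ?q W j" for P j
    proof -
      have "(\<Sum>k=1..K. ln (1 + P k * gc k)) < (\<Sum>k=1..K. ln (1 + ?q W k * gc k))"
        using P W gc m0 that(2,3)
        by (intro sum_ln_less_water_level[where m = ?m and W = W and j = j])
          (auto simp: feas water_filling_def)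
      then show ?thesis
        unfolding avg_rate_eq_sum_ln using assms(1) by (intro divide_strict_right_mono) auto
    qed
    \<comment> \<open>Allocations are functions on all of \<open>nat\<close>, so \<open>P\<close>
      may still differ from \<open>?q W\<close> outside the slots; \<open>less\<close> does not
      cover this case.\<close>
    have eq: "avg_rate K gc P = avg_rate K gc (?q W)" if "\<forall>k\<in>{1..K}. P k = ?q W k" for P
      using that by (simp add: avg_rate_def)
    have "\<not> avg_rate K gc (?q W) < avg_rate K gc P"
      if "feasible K Pmax \<Gamma>sen \<Gamma>com gc gs P" for P
      using less[OF that] eq[of P] by fastforce
    then show ?thesis
      unfolding optimal_def is_arg_max_def using q less by blast
  qed
  ultimately show ?thesis by blast
qed

end
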